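(* Let $\mu$ be a probabilistic frame for $\mathbb{R}^n$ with lower frame bound $A>0$ and let $\nu\in\mathcal{P}_2(\mathbb{R}^n)$. Suppose $W_2(\mu,\nu)<\sqrt{A}$. Then $\nu$ is a probabilistic frame for $\mathbb{R}^n$ with bounds $(\sqrt{A}-W_2(\mu,\nu))^2$ and $M_2(\nu)$. Furthermore, the set of probabilistic frames for $\mathbb{R}^n$ is an open subset of $\mathcal{P}_2(\mathbb{R}^n)$ endowed with the $2$-Wasserstein topology (the topology induced by the metric $W_2$).
   Context: $\mathcal{P}(\mathbb{R}^n)$ is the set of Borel probability measures on $\mathbb{R}^n$ and $\Vert\cdot\Vert$ is the Euclidean norm. The second moment of $\mu\in\mathcal{P}(\mathbb{R}^n)$ is $M_2(\mu) := \int_{\mathbb{R}^n}\Vert \mathbf{x}\Vert^2 d\mu(\mathbf{x})$, and $\mathcal{P}_2(\mathbb{R}^n)$ is the set of $\mu \in \mathcal{P}(\mathbb{R}^n)$ with $M_2(\mu)<+\infty$. A measure $\mu\in\mathcal{P}(\mathbb{R}^n)$ is a probabilistic frame for $\mathbb{R}^n$ with (frame) bounds $A$ and $B$, where $0<A\le B<\infty$, if for every $\mathbf{x}\in\mathbb{R}^n$, $A\Vert\mathbf{x}\Vert^2 \le \int_{\mathbb{R}^n} |\langle \mathbf{x},\mathbf{y}\rangle|^2 d\mu(\mathbf{y}) \le B\Vert\mathbf{x}\Vert^2$; $A$ is called a lower and $B$ an upper frame bound (the bounds need not be optimal). It is called a probabilistic frame if such $A,B$ exist. Every probabilistic frame belongs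 to $\mathcal{P}_2(\mathbb{R}^n)$. $\Gamma(\mu,\nu)$ denotes the set of transport couplings of $\mu$ and $\nu$: Borel probability measures $\gamma$ on $\mathbb{R}^n\times\mathbb{R}^n$ with first marginal $\mu$ and second marginal $\nu$. The $2$-Wasserstein distance is $W_2(\mu,\nu) := \left(\inf_{\gamma\in\Gamma(\mu,\nu)}\int_{\mathbb{R}^n\times\mathbb{R}^n}\Vert\mathbf{x}-\mathbf{y}\Vert^2 d\gamma(\mathbf{x},\mathbf{y})\right)^{1/2}$. *)

theory Defs
  imports "HOL-Probability.Probability"
begin

definition borel_prob :: "'a::topological_space measure set" where
  "borel_prob = {\<mu>. prob_space \<mu> \<and> sets \<mu> = sets borel}"

definition second_moment :: "(real ^ 'n) measure \<Rightarrow> ennreal" where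
  "second_moment \<mu> = (\<integral>\<^sup>+ x. ennreal ((norm x)\<^sup>2) \<partial>\<mu>)"

definition borel_prob2 :: "(real ^ 'n) measure set" where
  "borel_prob2 = {\<mu> \<in> borel_prob. second_moment \<mu> < \<infinity>}"

definition prob_frame_with_bounds :: "(real ^ 'n) measure \<Rightarrow> real \<Rightarrow> real \<Rightarrow> bool" where
  "prob_frame_with_bounds \<mu> A B \<longleftrightarrow>
     \<mu> \<in> borel_prob \<and> 0 < A \<and> A \<le> B \<and>
     (\<forall>x. ennreal (A * (norm x)\<^sup>2) \<le> (\<integral>\<^sup>+ y. ennreal (\<bar>x \<bullet> y\<bar>\<^sup>2) \<partial>\<mu>) \<and>
          (\<integral>\<^sup>+ y. ennreal (\<bar>x \<bullet> y\<bar>\<^sup>2) \<partial>\<mu>) \<le> ennreal (B * (norm x)\<^sup>2))"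

definition prob_frame :: "(real ^ 'n) measure \<Rightarrow> bool" where
  "prob_frame \<mu> \<longleftrightarrow> (\<exists>A B. prob_frame_with_bounds \<mu> A B)"

definition couplings ::
    "(real ^ 'n) measure \<Rightarrow> (real ^ 'n) measure \<Rightarrow> ((real ^ 'n) \<times> (real ^ 'n)) measure set" where
  "couplings \<mu> \<nu> = {\<gamma> \<in> borel_prob. distr \<gamma> borel fst = \<mu> \<and> distr \<gamma> borel snd = \<nu>}"

text \<open>
  Only meaningful as a distance on \<^const>\<open>borel_prob2\<close>, where the infimum is finite
  (the product coupling has finite cost); an infinite infimum is mapped to 0.
\<close>
definition W2 :: "(real ^ 'n) measure \<Rightarrow> (real ^ 'n) measure \<Rightarrow> real" where
  "W2 \<mu> \<nu> =
     sqrt (enn2real (INF \<gamma> \<in> couplings \<mu> \<nu>. \<integral>\<^sup>+ (x, y). ennreal ((norm (x - y))\<^sup>2) \<partial>\<gamma>))"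

text \<open>
  The metric topology of \<^const>\<open>W2\<close> on \<^const>\<open>borel_prob2\<close>, written out as
  \<^const>\<open>Metric_space.mtopology\<close> unfolds: the library's constant has a usable definition only
  once the metric axioms are established. The open sets below form a topology in any case,
  by \<open>openin_wasserstein_topology\<close>.
\<close>
definition wasserstein_topology :: "(real ^ 'n) measure topology" where
  "wasserstein_topology = topology (\<lambda>U. U \<subseteq> borel_prob2 \<and>
     (\<forall>\<mu>\<in>U. \<exists>r>0. {\<nu> \<in> borel_prob2. W2 \<mu> \<nu> < r} \<subseteq> U))"

lemma openin_wasserstein_topology:
  fixes U :: "(real ^ 'n) measure set"
  shows "openin wasserstein_topology U \<longleftrightarrow>
     U \<subseteq> borel_prob2 \<and> (\<forall>\<mu>\<in>U. \<exists>r>0. {\<nu> \<in> borel_prob2. W2 \<mu> \<nu> < r} \<subseteq> U)"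
proof -
  have "istopology (\<lambda>U :: (real ^ 'n) measure set. U \<subseteq> borel_prob2 \<and>
     (\<forall>\<mu>\<in>U. \<exists>r>0. {\<nu> \<in> borel_prob2. W2 \<mu> \<nu> < r} \<subseteq> U))" (is "istopology ?P")
    unfolding istopology_def
  proof (intro conjI allI impI)
    fix S T assume S: "?P S" and T: "?P T"
    show "S \<inter> T \<subseteq> borel_prob2" using S by blast
    show "\<forall>\<mu>\<in>S \<inter> T. \<exists>r>0. {\<nu> \<in> borel_prob2. W2 \<mu> \<nu> < r} \<subseteq> S \<inter> T"
    proof
      fix \<mu> assume "\<mu> \<in> S \<inter> T"
      then obtain r s where "r > 0" "s > 0"
        "{\<nu> \<in> borel_prob2. W2 \<mu> \<nu> < r} \<subseteq> S" "{\<nu> \<in> borel_prob2. W2 \<mu> \<nu> < s} \<subseteq> T"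
        using S T by blast
      then show "\<exists>r>0. {\<nu> \<in> borel_prob2. W2 \<mu> \<nu> < r} \<subseteq> S \<inter> T"
        by (intro exI[of _ "min r s"]) auto
    qed
  next
    fix \<K> assume K: "\<forall>K\<in>\<K>. ?P K"
    show "\<Union>\<K> \<subseteq> borel_prob2" using K by blast
    show "\<forall>\<mu>\<in>\<Union>\<K>. \<exists>r>0. {\<nu> \<in> borel_prob2. W2 \<mu> \<nu> < r} \<subseteq> \<Union>\<K>"
    proof
      fix \<mu> assume "\<mu> \<in> \<Union>\<K>"
      then obtain K where "K \<in> \<K>" "\<mu> \<in> K" by blast
      then obtain r where "r > 0" "{\<nu> \<in> borel_prob2. W2 \<mu> \<nu> < r} \<subseteq> K" using K by blast
      then show "\<exists>r>0. {\<nu> \<in> borel_prob2. W2 \<mu> \<nu> < r} \<subseteq> \<Union>\<K>"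
        using \<open>K \<in> \<K>\<close> by blast
    qed
  qed
  then show ?thesis
    unfolding wasserstein_topology_def by (simp add: topology_inverse')
qed

end

theory Submission
  imports Defs
begin

text \<open>
  Write \<open>I\<^sub>\<mu>(x)\<close> for the integral of \<open>\<bar>x \<bullet> y\<bar>\<^sup>2\<close> against \<open>\<mu>\<close>. Along a coupling of \<open>\<mu>\<close> and
  \<open>\<nu>\<close> the functions \<open>x \<bullet> y\<close> and \<open>x \<bullet> z\<close> differ by \<open>x \<bullet> (y - z)\<close>, whose \<open>L\<^sup>2\<close> norm is at most
  \<open>norm x\<close> times the square root of the transport cost. The triangle inequality in \<open>L\<^sup>2\<close>
  therefore gives \<open>sqrt (I\<^sub>\<mu>(x)) \<le> sqrt (I\<^sub>\<nu>(x)) + norm x * W2 \<mu> \<nu>\<close> after passing to the infimum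
  over couplings, and a lower bound \<open>A\<close> for \<open>\<mu>\<close> becomes the lower bound
  \<open>(sqrt A - W2 \<mu> \<nu>)\<^sup>2\<close> for \<open>\<nu>\<close>. The upper bound is Cauchy-Schwarz, and openness follows since
  the ball of radius \<open>sqrt A\<close> about a frame with lower bound \<open>A\<close> consists of frames.

  The triangle inequality is used in an integrated pointwise form (\<open>square_le_weighted\<close>):
  for \<open>0 < w < s\<close> the weighted inequality
  \<open>a\<^sup>2 \<le> s / (s - w) * b\<^sup>2 + s / w * (a - b)\<^sup>2\<close>, whose weights are the ones that are optimal when the
  norms of \<open>a\<close> and \<open>a - b\<close> are \<open>s\<close> and \<open>w\<close>, yields the sharp constant \<open>(s - w)\<^sup>2\<close> directly
  (\<open>coupling_lower_bound\<close>). Since it needs \<open>w > 0\<close>, it is applied with any \<open>w\<close> strictly between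
  the distance and \<open>sqrt A\<close>, and \<open>w\<close> then tends to the distance
  (\<open>frame_lower_bound_perturbation\<close>). That couplings of cost below \<open>w\<^sup>2\<close> exist depends on the infimum in
  \<^const>\<open>W2\<close> being finite; this holds because the product coupling has finite cost, frames
  having finite second moment (\<open>prob_frame_borel_prob2\<close>).
\<close>

section \<open>Moments and frame operators\<close>

lemma borel_prob_measurable_cong:
  assumes "\<mu> \<in> borel_prob"
  shows "measurable \<mu> N = measurable borel N"
  using assms by (intro measurable_cong_sets) (auto simp: borel_prob_def)

lemma second_moment_eq_sum_Basis:
  fixes \<mu> :: "(real ^ 'n) measure"
  assumes "\<mu> \<in> borel_prob"
  shows "second_moment \<mu> = (\<Sum>b\<in>Basis. \<integral>\<^sup>+ y. ennreal (\<bar>b \<bullet> y\<bar>\<^sup>2) \<partial>\<mu>)"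
proof -
  have "second_moment \<mu> = (\<integral>\<^sup>+ y. (\<Sum>b\<in>Basis. ennreal (\<bar>b \<bullet> y\<bar>\<^sup>2)) \<partial>\<mu>)"
    unfolding second_moment_def
  proof (intro nn_integral_cong)
    fix y :: "real ^ 'n"
    have "(norm y)\<^sup>2 = (\<Sum>b\<in>Basis. \<bar>b \<bullet> y\<bar>\<^sup>2)"
      by (subst power2_norm_eq_inner, subst euclidean_inner)
        (simp add: power2_eq_square inner_commute)
    then show "ennreal ((norm y)\<^sup>2) = (\<Sum>b\<in>Basis. ennreal (\<bar>b \<bullet> y\<bar>\<^sup>2))"
      by (simp add: sum_ennreal)
  qed
  also have "\<dots> = (\<Sum>b\<in>Basis. \<integral>\<^sup>+ y. ennreal (\<bar>b \<bullet> y\<bar>\<^sup>2) \<partial>\<mu>)"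
    by (intro nn_integral_sum) (simp add: borel_prob_measurable_cong[OF assms])
  finally show ?thesis .
qed

lemma prob_frame_borel_prob2:
  fixes \<mu> :: "(real ^ 'n) measure"
  assumes "prob_frame_with_bounds \<mu> A B"
  shows "\<mu> \<in> borel_prob2"
proof -
  have mu: "\<mu> \<in> borel_prob" using assms by (simp add: prob_frame_with_bounds_def)
  have "(\<integral>\<^sup>+ y. ennreal (\<bar>b \<bullet> y\<bar>\<^sup>2) \<partial>\<mu>) < \<infinity>" for b
    using assms le_less_trans[OF _ ennreal_less_top]
    unfolding prob_frame_with_bounds_def infinity_ennreal_def by blast
  then have "second_moment \<mu> < \<infinity>"
    unfolding second_moment_eq_sum_Basis[OF mu] by (simp add: less_top)
  with mu show ?thesis by (simp add: borel_prob2_def)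
qed

lemma nn_integral_inner_le_second_moment:
  fixes \<nu> :: "(real ^ 'n) measure"
  assumes "\<nu> \<in> borel_prob2"
  shows "(\<integral>\<^sup>+ y. ennreal (\<bar>x \<bullet> y\<bar>\<^sup>2) \<partial>\<nu>) \<le> ennreal (enn2real (second_moment \<nu>) * (norm x)\<^sup>2)"
proof -
  have nu: "\<nu> \<in> borel_prob" and fin: "second_moment \<nu> < top"
    using assms by (auto simp: borel_prob2_def)
  have "(\<integral>\<^sup>+ y. ennreal (\<bar>x \<bullet> y\<bar>\<^sup>2) \<partial>\<nu>) \<le> (\<integral>\<^sup>+ y. ennreal ((norm x)\<^sup>2) * ennreal ((norm y)\<^sup>2) \<partial>\<nu>)"
  proof (intro nn_integral_mono)
    fix y :: "real ^ 'n"
    have "\<bar>x \<bullet> y\<bar>\<^sup>2 \<le> (norm x * norm y)\<^sup>2"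
      by (intro power_mono Cauchy_Schwarz_ineq2) simp
    then show "ennreal (\<bar>x \<bullet> y\<bar>\<^sup>2) \<le> ennreal ((norm x)\<^sup>2) * ennreal ((norm y)\<^sup>2)"
      by (simp add: ennreal_mult[symmetric] power_mult_distrib)
  qed
  also have "\<dots> = ennreal ((norm x)\<^sup>2) * second_moment \<nu>"
    unfolding second_moment_def
    by (intro nn_integral_cmult) (simp add: borel_prob_measurable_cong[OF nu])
  also have "\<dots> = ennreal (enn2real (second_moment \<nu>) * (norm x)\<^sup>2)"
    using fin by (simp add: ennreal_mult mult.commute)
  finally show ?thesis .
qed

section \<open>Couplings\<close>

lemma couplings_nn_integral:
  fixes \<mu> \<nu> :: "(real ^ 'n) measure"
  assumes "\<gamma> \<in> couplings \<mu> \<nu>" and f: "f \<in> borel_measurable borel"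
  shows "(\<integral>\<^sup>+ y. f y \<partial>\<mu>) = (\<integral>\<^sup>+ p. f (fst p) \<partial>\<gamma>)"
    and "(\<integral>\<^sup>+ z. f z \<partial>\<nu>) = (\<integral>\<^sup>+ p. f (snd p) \<partial>\<gamma>)"
proof -
  have g: "\<gamma> \<in> borel_prob" "distr \<gamma> borel fst = \<mu>" "distr \<gamma> borel snd = \<nu>"
    using assms(1) by (auto simp: couplings_def)
  have m: "fst \<in> measurable \<gamma> borel" "snd \<in> measurable \<gamma> borel"
    unfolding borel_prob_measurable_cong[OF g(1)]
    by (auto intro!: borel_measurable_continuous_onI continuous_intros)
  have f': "f \<in> borel_measurable (distr \<gamma> borel h)" for h :: "_ \<Rightarrow> real ^ 'n"
    using f by simp
  show "(\<integral>\<^sup>+ y. f y \<partial>\<mu>) = (\<integral>\<^sup>+ p. f (fst p) \<partial>\<gamma>)"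
    using nn_integral_distr[OF m(1) f'] g(2) by simp
  show "(\<integral>\<^sup>+ z. f z \<partial>\<nu>) = (\<integral>\<^sup>+ p. f (snd p) \<partial>\<gamma>)"
    using nn_integral_distr[OF m(2) f'] g(3) by simp
qed

lemma pair_measure_in_couplings:
  fixes \<mu> \<nu> :: "(real ^ 'n) measure"
  assumes "\<mu> \<in> borel_prob" "\<nu> \<in> borel_prob"
  shows "\<mu> \<Otimes>\<^sub>M \<nu> \<in> couplings \<mu> \<nu>"
proof -
  interpret M: prob_space \<mu> using assms by (simp add: borel_prob_def)
  interpret N: prob_space \<nu> using assms by (simp add: borel_prob_def)
  interpret P: pair_prob_space \<mu> \<nu> ..
  have s: "sets \<mu> = sets borel" "sets \<nu> = sets borel"
    using assms by (auto simp: borel_prob_def)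
  have sp: "sets (\<mu> \<Otimes>\<^sub>M \<nu>) = sets borel"
    using sets_pair_measure_cong[OF s] unfolding borel_prod .
  have m: "fst \<in> measurable (\<mu> \<Otimes>\<^sub>M \<nu>) borel" "snd \<in> measurable (\<mu> \<Otimes>\<^sub>M \<nu>) borel"
    using measurable_cong_sets[OF refl s(1), of "\<mu> \<Otimes>\<^sub>M \<nu>"]
      measurable_cong_sets[OF refl s(2), of "\<mu> \<Otimes>\<^sub>M \<nu>"] by auto
  have "distr (\<mu> \<Otimes>\<^sub>M \<nu>) borel fst = \<mu>"
    using N.distr_pair_fst[of \<mu>] distr_cong[OF refl s(1), of "\<mu> \<Otimes>\<^sub>M \<nu>" fst fst] by simp
  moreover have "distr (\<mu> \<Otimes>\<^sub>M \<nu>) borel snd = \<nu>"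
  proof (rule measure_eqI)
    fix A assume "A \<in> sets (distr (\<mu> \<Otimes>\<^sub>M \<nu>) borel snd)"
    then have A: "A \<in> sets \<nu>" using s by simp
    have "snd -` A \<inter> space (\<mu> \<Otimes>\<^sub>M \<nu>) = space \<mu> \<times> A"
      using sets.sets_into_space[OF A] by (auto simp: space_pair_measure)
    with A show "emeasure (distr (\<mu> \<Otimes>\<^sub>M \<nu>) borel snd) A = emeasure \<nu> A"
      using s m N.emeasure_pair_measure_Times[OF sets.top[of \<mu>] A]
      by (simp add: emeasure_distr M.emeasure_space_1)
  qed (use s in simp)
  ultimately show ?thesis
    using sp P.prob_space_axioms by (simp add: couplings_def borel_prob_def)
qed

lemma couplings_cost_finite:
  fixes \<mu> \<nu> :: "(real ^ 'n) measure"
  assumes "\<mu> \<in> borel_prob2" "\<nu> \<in> borel_prob2" and \<gamma>: "\<gamma> \<in> couplings \<mu> \<nu>"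
  shows "(\<integral>\<^sup>+ (x, y). ennreal ((norm (x - y))\<^sup>2) \<partial>\<gamma>) < \<infinity>"
proof -
  have g: "\<gamma> \<in> borel_prob" using \<gamma> by (simp add: couplings_def)
  have "(\<integral>\<^sup>+ (x, y). ennreal ((norm (x - y))\<^sup>2) \<partial>\<gamma>)
      \<le> (\<integral>\<^sup>+ p. 2 * ennreal ((norm (fst p))\<^sup>2) + 2 * ennreal ((norm (snd p))\<^sup>2) \<partial>\<gamma>)"
  proof (intro nn_integral_mono, clarify)
    fix x y :: "real ^ 'n"
    have "(norm (x - y))\<^sup>2 \<le> (norm x + norm y)\<^sup>2"
      by (intro power_mono norm_triangle_ineq4) simp
    also have "\<dots> \<le> 2 * (norm x)\<^sup>2 + 2 * (norm y)\<^sup>2"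
      using zero_le_power2[of "norm x - norm y"] by (simp add: power2_eq_square algebra_simps)
    finally have "ennreal ((norm (x - y))\<^sup>2) \<le> ennreal (2 * (norm x)\<^sup>2 + 2 * (norm y)\<^sup>2)"
      by (rule ennreal_leI)
    also have "\<dots> = 2 * ennreal ((norm x)\<^sup>2) + 2 * ennreal ((norm y)\<^sup>2)"
      by (simp add: ennreal_mult)
    finally show "ennreal ((norm (x - y))\<^sup>2)
        \<le> 2 * ennreal ((norm (fst (x, y)))\<^sup>2) + 2 * ennreal ((norm (snd (x, y)))\<^sup>2)"
      by simp
  qed
  also have "\<dots> = 2 * second_moment \<mu> + 2 * second_moment \<nu>"
    unfolding second_moment_def couplings_nn_integral(1)[OF \<gamma>, of "\<lambda>y. ennreal ((norm y)\<^sup>2)", simplified]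
      couplings_nn_integral(2)[OF \<gamma>, of "\<lambda>y. ennreal ((norm y)\<^sup>2)", simplified]
    by (simp add: nn_integral_add nn_integral_cmult borel_prob_measurable_cong[OF g] borel_prod[symmetric])
  also have "\<dots> < \<infinity>"
    using assms(1,2) by (auto simp: borel_prob2_def ennreal_mult_less_top)
  finally show ?thesis .
qed

lemma W2_nonneg: "0 \<le> W2 \<mu> \<nu>"
  by (simp add: W2_def)

text \<open>
  Finiteness of the infimum enters here: an infinite infimum would make \<^const>\<open>W2\<close> zero without
  any coupling of small cost.
\<close>
lemma coupling_cost_less:
  fixes \<mu> \<nu> :: "(real ^ 'n) measure"
  assumes "\<mu> \<in> borel_prob2" "\<nu> \<in> borel_prob2" "W2 \<mu> \<nu> < w"
  obtains \<gamma> where "\<gamma> \<in> couplings \<mu> \<nu>"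
    "(\<integral>\<^sup>+ (x, y). ennreal ((norm (x - y))\<^sup>2) \<partial>\<gamma>) < ennreal (w\<^sup>2)"
proof -
  define I where
    "I = (INF \<gamma> \<in> couplings \<mu> \<nu>. \<integral>\<^sup>+ (x, y). ennreal ((norm (x - y))\<^sup>2) \<partial>\<gamma>)"
  have P: "\<mu> \<Otimes>\<^sub>M \<nu> \<in> couplings \<mu> \<nu>"
    using assms by (intro pair_measure_in_couplings) (auto simp: borel_prob2_def)
  have "I < top"
    unfolding I_def using couplings_cost_finite[OF assms(1,2) P]
    by (intro le_less_trans[OF INF_lower[OF P]]) simp
  moreover have "enn2real I < w\<^sup>2"
  proof -
    have "sqrt (enn2real I) < w" using assms(3) by (simp add: W2_def I_def)
    then show ?thesis
      by (metis enn2real_nonneg power_strict_mono real_sqrt_ge_zero real_sqrt_pow2 zero_less_numeral)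
  qed
  ultimately have "I < ennreal (w\<^sup>2)"
    by (metis enn2real_nonneg ennreal_enn2real ennreal_lessI ennreal_less_iff)
  then show thesis
    unfolding I_def INF_less_iff using that by blast
qed

section \<open>Perturbation of the lower frame bound\<close>

text \<open>
  The difference of the two sides is the square of \<open>w * b - (s - w) * (a - b)\<close>, up to the
  positive factor \<open>w * (s - w)\<close>.
\<close>
lemma square_le_weighted:
  fixes a b s w :: real
  assumes "0 < w" "w < s"
  shows "a\<^sup>2 \<le> s / (s - w) * b\<^sup>2 + s / w * (a - b)\<^sup>2"
proof -
  have "s / (s - w) * b\<^sup>2 + s / w * (a - b)\<^sup>2 - a\<^sup>2
      = (w * b - (s - w) * (a - b))\<^sup>2 / (w * (s - w))"
    using assms by (simp add: field_simps) (simp add: power2_eq_square algebra_simps)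
  also have "\<dots> \<ge> 0" using assms by simp
  finally show ?thesis by simp
qed

text \<open>
  Integrating the weighted inequality gives
  \<open>s\<^sup>2 \<le> s / (s - w) * I + s / w * w\<^sup>2\<close> for the \<open>\<nu>\<close>-integral \<open>I\<close> at a unit vector, and solving
  for \<open>I\<close> leaves exactly \<open>(s - w)\<^sup>2\<close>.
\<close>
lemma coupling_lower_bound:
  fixes \<mu> \<nu> :: "(real ^ 'n) measure"
  assumes \<gamma>: "\<gamma> \<in> couplings \<mu> \<nu>"
    and cost: "(\<integral>\<^sup>+ (x, y). ennreal ((norm (x - y))\<^sup>2) \<partial>\<gamma>) \<le> ennreal (w\<^sup>2)"
    and w: "0 < w" "w < s"
    and lower: "ennreal (s\<^sup>2 * (norm x)\<^sup>2) \<le> (\<integral>\<^sup>+ y. ennreal (\<bar>x \<bullet> y\<bar>\<^sup>2) \<partial>\<mu>)"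
  shows "ennreal ((s - w)\<^sup>2 * (norm x)\<^sup>2) \<le> (\<integral>\<^sup>+ z. ennreal (\<bar>x \<bullet> z\<bar>\<^sup>2) \<partial>\<nu>)"
proof (cases "(\<integral>\<^sup>+ z. ennreal (\<bar>x \<bullet> z\<bar>\<^sup>2) \<partial>\<nu>)")
  case (real r)
  have g: "\<gamma> \<in> borel_prob" using \<gamma> by (simp add: couplings_def)
  have J: "(\<integral>\<^sup>+ p. ennreal (\<bar>x \<bullet> snd p\<bar>\<^sup>2) \<partial>\<gamma>) = ennreal r"
    using real(2) couplings_nn_integral(2)[OF \<gamma>, of "\<lambda>y. ennreal (\<bar>x \<bullet> y\<bar>\<^sup>2)"] by simp
  have C: "(\<integral>\<^sup>+ p. ennreal ((norm (fst p - snd p))\<^sup>2) \<partial>\<gamma>) \<le> ennreal (w\<^sup>2)"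
    using cost by (simp add: case_prod_unfold)
  have "ennreal (s\<^sup>2 * (norm x)\<^sup>2) \<le> (\<integral>\<^sup>+ p. ennreal (\<bar>x \<bullet> fst p\<bar>\<^sup>2) \<partial>\<gamma>)"
    using lower couplings_nn_integral(1)[OF \<gamma>, of "\<lambda>y. ennreal (\<bar>x \<bullet> y\<bar>\<^sup>2)"] by simp
  also have "\<dots> \<le> (\<integral>\<^sup>+ p. ennreal (s / (s - w)) * ennreal (\<bar>x \<bullet> snd p\<bar>\<^sup>2)
      + ennreal (s / w * (norm x)\<^sup>2) * ennreal ((norm (fst p - snd p))\<^sup>2) \<partial>\<gamma>)"
  proof (intro nn_integral_mono)
    fix p :: "(real ^ 'n) \<times> (real ^ 'n)"
    have "(x \<bullet> fst p)\<^sup>2 \<le> s / (s - w) * (x \<bullet> snd p)\<^sup>2 + s / w * (x \<bullet> fst p - x \<bullet> snd p)\<^sup>2"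
      by (rule square_le_weighted[OF w])
    also have "(x \<bullet> fst p - x \<bullet> snd p)\<^sup>2 \<le> (norm x * norm (fst p - snd p))\<^sup>2"
      unfolding inner_diff_right[symmetric]
      by (rule abs_le_square_iff[THEN iffD1]) (simp add: Cauchy_Schwarz_ineq2 abs_mult)
    finally have "(x \<bullet> fst p)\<^sup>2
        \<le> s / (s - w) * (x \<bullet> snd p)\<^sup>2 + (s / w * (norm x)\<^sup>2) * (norm (fst p - snd p))\<^sup>2"
      using w by (simp add: power_mult_distrib mult.assoc mult_left_mono divide_right_mono)
    then have "ennreal ((x \<bullet> fst p)\<^sup>2) \<le> ennreal (s / (s - w) * (x \<bullet> snd p)\<^sup>2
        + (s / w * (norm x)\<^sup>2) * (norm (fst p - snd p))\<^sup>2)"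
      by (rule ennreal_leI)
    then show "ennreal (\<bar>x \<bullet> fst p\<bar>\<^sup>2) \<le> ennreal (s / (s - w)) * ennreal (\<bar>x \<bullet> snd p\<bar>\<^sup>2)
        + ennreal (s / w * (norm x)\<^sup>2) * ennreal ((norm (fst p - snd p))\<^sup>2)"
      using w by (simp add: ennreal_mult[symmetric] ennreal_plus[symmetric] del: ennreal_plus)
  qed
  also have "\<dots> = ennreal (s / (s - w)) * ennreal r
      + ennreal (s / w * (norm x)\<^sup>2) * (\<integral>\<^sup>+ p. ennreal ((norm (fst p - snd p))\<^sup>2) \<partial>\<gamma>)"
    by (simp add: nn_integral_add nn_integral_cmult J[simplified] borel_prob_measurable_cong[OF g]
        borel_prod[symmetric])
  also have "\<dots> \<le> ennreal (s / (s - w)) * ennreal r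
      + ennreal (s / w * (norm x)\<^sup>2) * ennreal (w\<^sup>2)"
    by (intro add_left_mono mult_left_mono C) simp
  also have "\<dots> = ennreal (s / (s - w) * r + s / w * (norm x)\<^sup>2 * w\<^sup>2)"
    using w real(1) by (simp add: ennreal_mult[symmetric] ennreal_plus[symmetric] del: ennreal_plus)
  finally have "s\<^sup>2 * (norm x)\<^sup>2 \<le> s / (s - w) * r + s / w * (norm x)\<^sup>2 * w\<^sup>2"
    using w real(1) by (subst (asm) ennreal_le_iff) auto
  then have "s * (s * (norm x)\<^sup>2) \<le> s * (r / (s - w) + w * (norm x)\<^sup>2)"
    using w by (simp add: power2_eq_square algebra_simps)
  then have "s * (norm x)\<^sup>2 \<le> r / (s - w) + w * (norm x)\<^sup>2"
    using w by (auto dest: mult_left_le_imp_le)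
  then have "(s - w) * (norm x)\<^sup>2 \<le> r / (s - w)"
    by (simp add: algebra_simps)
  then have "(s - w)\<^sup>2 * (norm x)\<^sup>2 \<le> r"
    using w by (simp add: pos_le_divide_eq power2_eq_square mult_ac)
  then show ?thesis
    using real by (simp add: ennreal_leI)
qed simp

lemma frame_lower_bound_perturbation:
  fixes \<mu> \<nu> :: "(real ^ 'n) measure"
  assumes "\<mu> \<in> borel_prob2" "\<nu> \<in> borel_prob2" and less: "W2 \<mu> \<nu> < s"
    and lower: "ennreal (s\<^sup>2 * (norm x)\<^sup>2) \<le> (\<integral>\<^sup>+ y. ennreal (\<bar>x \<bullet> y\<bar>\<^sup>2) \<partial>\<mu>)"
  shows "ennreal ((s - W2 \<mu> \<nu>)\<^sup>2 * (norm x)\<^sup>2) \<le> (\<integral>\<^sup>+ z. ennreal (\<bar>x \<bullet> z\<bar>\<^sup>2) \<partial>\<nu>)"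
proof -
  have "\<forall>\<^sub>F w in at_right (W2 \<mu> \<nu>). w \<in> {W2 \<mu> \<nu><..<s}"
    by (rule eventually_at_right_real[OF less])
  then have "\<forall>\<^sub>F w in at_right (W2 \<mu> \<nu>).
      ennreal ((s - w)\<^sup>2 * (norm x)\<^sup>2) \<le> (\<integral>\<^sup>+ z. ennreal (\<bar>x \<bullet> z\<bar>\<^sup>2) \<partial>\<nu>)"
  proof eventually_elim
    case (elim w)
    then have w: "W2 \<mu> \<nu> < w" "0 < w" "w < s"
      using W2_nonneg[of \<mu> \<nu>] by auto
    from coupling_cost_less[OF assms(1,2) w(1)] show ?case
      using coupling_lower_bound[OF _ less_imp_le w(2,3) lower] by blast
  qed
  moreover have "((\<lambda>w. ennreal ((s - w)\<^sup>2 * (norm x)\<^sup>2)) \<longlongrightarrow>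
      ennreal ((s - W2 \<mu> \<nu>)\<^sup>2 * (norm x)\<^sup>2)) (at_right (W2 \<mu> \<nu>))"
    by (intro tendsto_ennrealI tendsto_intros)
  ultimately show ?thesis
    by (intro tendsto_upperbound) auto
qed

lemma prob_frame_with_bounds_perturbation:
  fixes \<mu> \<nu> :: "(real ^ 'n) measure"
  assumes \<mu>: "prob_frame_with_bounds \<mu> A B" and \<nu>: "\<nu> \<in> borel_prob2"
    and less: "W2 \<mu> \<nu> < sqrt A"
  shows "prob_frame_with_bounds \<nu> ((sqrt A - W2 \<mu> \<nu>)\<^sup>2) (enn2real (second_moment \<nu>))"
proof -
  have "0 < A" using \<mu> by (simp add: prob_frame_with_bounds_def)
  then have low: "ennreal ((sqrt A - W2 \<mu> \<nu>)\<^sup>2 * (norm x)\<^sup>2)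
      \<le> (\<integral>\<^sup>+ z. ennreal (\<bar>x \<bullet> z\<bar>\<^sup>2) \<partial>\<nu>)" for x
    using \<mu> by (intro frame_lower_bound_perturbation prob_frame_borel_prob2[OF \<mu>] \<nu> less)
      (simp add: prob_frame_with_bounds_def)
  note upp = nn_integral_inner_le_second_moment[OF \<nu>]
  \<comment> \<open>The two bounds are compared by evaluating both estimates at a unit vector.\<close>
  obtain e :: "real ^ 'n" where "norm e = 1"
    using vector_choose_size[of 1] by auto
  then have "(sqrt A - W2 \<mu> \<nu>)\<^sup>2 \<le> enn2real (second_moment \<nu>)"
    using order_trans[OF low[of e] upp[of e]] by (simp add: ennreal_le_iff)
  then show ?thesis
    using low upp less \<nu> by (auto simp: prob_frame_with_bounds_def borel_prob2_def)
qed

theorem corollary1p3: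
  shows "(\<forall>(\<mu> :: (real ^ 'n) measure) \<nu> A.
            (\<exists>B. prob_frame_with_bounds \<mu> A B) \<and> \<nu> \<in> borel_prob2 \<and> W2 \<mu> \<nu> < sqrt A \<longrightarrow>
            prob_frame_with_bounds \<nu> ((sqrt A - W2 \<mu> \<nu>)\<^sup>2) (enn2real (second_moment \<nu>)))
       \<and> openin wasserstein_topology {\<mu> :: (real ^ 'n) measure. prob_frame \<mu>}"
proof
  show "\<forall>(\<mu> :: (real ^ 'n) measure) \<nu> A.
            (\<exists>B. prob_frame_with_bounds \<mu> A B) \<and> \<nu> \<in> borel_prob2 \<and> W2 \<mu> \<nu> < sqrt A \<longrightarrow>
            prob_frame_with_bounds \<nu> ((sqrt A - W2 \<mu> \<nu>)\<^sup>2) (enn2real (second_moment \<nu>))"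
    using prob_frame_with_bounds_perturbation by blast
  show "openin wasserstein_topology {\<mu> :: (real ^ 'n) measure. prob_frame \<mu>}"
    unfolding openin_wasserstein_topology
  proof (intro conjI ballI)
    show "{\<mu> :: (real ^ 'n) measure. prob_frame \<mu>} \<subseteq> borel_prob2"
      using prob_frame_borel_prob2 by (auto simp: prob_frame_def)
  next
    fix \<mu> :: "(real ^ 'n) measure"
    assume "\<mu> \<in> {\<mu>. prob_frame \<mu>}"
    then obtain A B where AB: "prob_frame_with_bounds \<mu> A B"
      by (auto simp: prob_frame_def)
    then have "sqrt A > 0" by (simp add: prob_frame_with_bounds_def)
    moreover have "{\<nu> \<in> borel_prob2. W2 \<mu> \<nu> < sqrt A} \<subseteq> {\<mu>. prob_frame \<mu>}"
      using prob_frame_with_bounds_perturbation[OF AB] by (auto simp: prob_frame_def)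
    ultimately show "\<exists>r>0. {\<nu> \<in> borel_prob2. W2 \<mu> \<nu> < r} \<subseteq> {\<mu>. prob_frame \<mu>}"
      by blast
  qed
qed

end
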